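(* Let $T\subseteq\mathbb{R}^n$ be a polyhedral cone with $\ell$ facets $T^1,\dots,T^\ell$ and associated inward unit normals $s^1,\dots,s^\ell$. For $w\in\mathbb{R}^n$, let $$F(T,w):=\frac{1}{\sqrt{2\pi}}\sum_{i=1}^\ell\gamma_{\mathrm{rel}}(T^i)\,(s^i\cdot w)_+ .$$ Then $$\gamma(M(T,w))\ \le\ 2F(T,w)\exp\big(\sqrt{n-1}\,\|w\|\big).$$ If $w\in T$, then $$\gamma(M(T,w))\ \ge\ F(T,w)\exp\big(-\sqrt{n-1}\,\|w\|-\tfrac12\|w\|^2\big).$$
   Context: The polyhedral cone is described by its inward facet unit normals: $T=\{y\in\mathbb{R}^n\mid y\cdot s^i\ge0\ \text{for all } i\in\{1,\dots,\ell\}\}$ is full-dimensional, with facets $T^i=\{y\in T\mid s^i\cdot y=0\}$ being its $(n-1)$-dimensional faces. The margin is $M(T,w)=T\setminus[T+w]$. $\gamma$ is the standard Gaussian measure on $\mathbb{R}^n$. For a cone $K\subseteq\mathbb{R}^n$, the relative Gaussian measure is $\gamma_{\mathrm{rel}}(K)=\mathbb{P}(\mathrm{proj}_{\mathrm{span}(K)}\,g\in K)$ with $g\sim\mathcal N(0,I_n)$. For real $a$, $a_+=\max(0,a)$. *)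

theory Defs
  imports "HOL-Probability.Probability"
begin

text \<open>The law of a vector whose coordinates are independent standard normal variables.\<close>

definition std_gaussian :: "'a::euclidean_space measure" where
  "std_gaussian = density lborel (\<lambda>x. ennreal (\<Prod>b\<in>Basis. std_normal_density (x \<bullet> b)))"

definition orth_proj :: "'a::euclidean_space set \<Rightarrow> 'a \<Rightarrow> 'a" where
  "orth_proj V x = (THE y. y \<in> V \<and> (\<forall>v\<in>V. orthogonal (x - y) v))"

text \<open>For a linear subspace the description above determines the projection.\<close>

lemma orth_proj_ex1:
  fixes V :: "'a::euclidean_space set"
  assumes "subspace V"
  shows "\<exists>!y. y \<in> V \<and> (\<forall>v\<in>V. orthogonal (x - y) v)"
proof (rule ex_ex1I)
  obtain y z where "y \<in> span V" "\<And>v. v \<in> span V \<Longrightarrow> orthogonal z v" "x = y + z"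
    using orthogonal_subspace_decomp_exists[of V x] by metis
  moreover have "span V = V"
    using assms by (simp add: span_eq_iff)
  ultimately show "\<exists>y. y \<in> V \<and> (\<forall>v\<in>V. orthogonal (x - y) v)"
    by (intro exI[of _ y]) auto
next
  fix y z
  assume y: "y \<in> V \<and> (\<forall>v\<in>V. orthogonal (x - y) v)"
    and z: "z \<in> V \<and> (\<forall>v\<in>V. orthogonal (x - z) v)"
  have "y - z \<in> V"
    using assms y z by (simp add: subspace_diff)
  then have "(x - z) \<bullet> (y - z) - (x - y) \<bullet> (y - z) = 0"
    using y z by (simp add: orthogonal_def)
  then have "(y - z) \<bullet> (y - z) = 0"
    by (simp add: inner_diff_left)
  then show "y = z"
    by simp
qed

definition gaussian_rel :: "'a::euclidean_space set \<Rightarrow> real" where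
  "gaussian_rel K = measure std_gaussian {g. orth_proj (span K) g \<in> K}"

definition margin :: "'a::euclidean_space set \<Rightarrow> 'a \<Rightarrow> 'a set" where
  "margin T w = T - (\<lambda>y. y + w) ` T"

definition cone_facet :: "'a::euclidean_space set \<Rightarrow> 'a \<Rightarrow> 'a set" where
  "cone_facet T u = {y \<in> T. u \<bullet> y = 0}"

text \<open>
  \<^term>\<open>s 1\<close>, ..., \<^term>\<open>s l\<close> are the inward unit normals of a full-dimensional polyhedral cone
  \<^term>\<open>T\<close>, one for each facet.  The bijection excludes redundant and repeated normals.
  The case \<open>l = 0\<close>, where \<^term>\<open>T\<close> is the whole space, is included.
\<close>

definition polyhedral_cone_normals ::
    "'a::euclidean_space set \<Rightarrow> nat \<Rightarrow> (nat \<Rightarrow> 'a) \<Rightarrow> bool" where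
  "polyhedral_cone_normals T l s \<longleftrightarrow>
     T = {y. \<forall>i\<in>{1..l}. y \<bullet> s i \<ge> 0} \<and>
     aff_dim T = int DIM('a) \<and>
     (\<forall>i\<in>{1..l}. norm (s i) = 1) \<and>
     bij_betw (\<lambda>i. cone_facet T (s i)) {1..l} {F. F facet_of T}"

definition margin_F :: "'a::euclidean_space set \<Rightarrow> nat \<Rightarrow> (nat \<Rightarrow> 'a) \<Rightarrow> 'a \<Rightarrow> real" where
  "margin_F T l s w =
     1 / sqrt (2 * pi) * (\<Sum>i = 1..l. gaussian_rel (cone_facet T (s i)) * max 0 (s i \<bullet> w))"

end

theory Submission
  imports Defs
begin

text \<open>
  The margin is covered by the sets \<open>T\<^sup>i + [0,1) w\<close> over the facets \<open>T\<^sup>i\<close> with \<open>s\<^sup>i \<bullet> w > 0\<close>,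
  and up to null sets it is their disjoint union if \<open>w \<in> T\<close>.  By Fubini the Gaussian measure of such
  a set is \<open>(s\<^sup>i \<bullet> w) / \<surd>(2\<pi>)\<close> times the average over \<open>t \<in> [0,1)\<close> of the integral of
  \<open>exp (- t x \<bullet> w - t\<^sup>2 |w|\<^sup>2 / 2)\<close> over \<open>T\<^sup>i\<close> against the Gaussian measure of the hyperplane.  By the
  Cauchy--Schwarz inequality only exponential moments of \<open>|x|\<close> on the cone \<open>T\<^sup>i\<close> matter.  The
  moments of \<open>exp (\<alpha> |x|\<^sup>2 / 2)\<close> follow from scaling, and \<open>a r \<le> (\<alpha> r\<^sup>2 + a\<^sup>2 / \<alpha>) / 2\<close> with the
  optimal \<open>\<alpha>\<close> gives the upper bound, even without the factor 2; the lower bound uses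
  \<open>a r \<le> a (r\<^sup>2 / \<surd>(n-1) + \<surd>(n-1)) / 2\<close>.
\<close>

subsection \<open>Orthogonal invariance of Lebesgue measure\<close>

lemma nn_integral_lborel_add:
  fixes f :: "'a::euclidean_space \<Rightarrow> ennreal"
  assumes [measurable]: "f \<in> borel_measurable borel"
  shows "(\<integral>\<^sup>+x. f (x + c) \<partial>lborel) = (\<integral>\<^sup>+x. f x \<partial>lborel)"
proof -
  have "(\<integral>\<^sup>+x. f x \<partial>lborel) = (\<integral>\<^sup>+x. f x \<partial>distr lborel borel ((+) c))"
    by (simp only: lborel_distr_plus)
  then show ?thesis
    by (simp add: nn_integral_distr add.commute)
qed

lemma nn_integral_lborel_scale:
  fixes f :: "'a::euclidean_space \<Rightarrow> ennreal"
  assumes [measurable]: "f \<in> borel_measurable borel" and b: "b > 0"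
  shows "(\<integral>\<^sup>+x. f (b *\<^sub>R x) \<partial>lborel) = ennreal ((1 / b) ^ DIM('a)) * (\<integral>\<^sup>+x. f x \<partial>lborel)"
proof -
  have "lborel = density (distr lborel borel (\<lambda>x::'a. 0 + (1 / b) *\<^sub>R x)) (\<lambda>_. ennreal (\<bar>1 / b\<bar> ^ DIM('a)))"
    using b by (intro lborel_affine) auto
  then have "(\<integral>\<^sup>+x. f (b *\<^sub>R x) \<partial>lborel) =
      (\<integral>\<^sup>+x. f (b *\<^sub>R x)
        \<partial>density (distr lborel borel (\<lambda>x::'a. 0 + (1 / b) *\<^sub>R x)) (\<lambda>_. ennreal (\<bar>1 / b\<bar> ^ DIM('a))))"
    by simp
  also have "\<dots> = (\<integral>\<^sup>+x. ennreal ((1 / b) ^ DIM('a)) * f x \<partial>lborel)"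
    using b by (subst nn_integral_density) (simp_all add: nn_integral_distr)
  finally show ?thesis
    by (simp add: nn_integral_cmult)
qed

text \<open>
  The usual uniqueness argument for Haar measure: by Fubini and translation invariance,
  \<open>distr lborel borel f\<close> is a multiple of \<open>lborel\<close>, and the unit ball shows that the factor is 1.
\<close>

lemma lborel_distr_orthogonal_transformation:
  fixes f :: "'a::euclidean_space \<Rightarrow> 'a"
  assumes f: "orthogonal_transformation f"
  shows "distr lborel borel f = lborel"
proof (rule measure_eqI)
  have lin: "linear f" and norm_f: "norm (f x) = norm x" for x
    using f by (simp_all add: orthogonal_transformation)
  have [measurable]: "f \<in> borel_measurable borel"
    using lin by (intro borel_measurable_continuous_onI linear_continuous_on)
      (simp add: linear_conv_bounded_linear)
  obtain g where fg: "f (g y) = y" for y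
    using orthogonal_transformation_surj[OF f] by (metis surj_def)
  have f_add: "f (x + y) = f x + f y" for x y
    using lin by (rule linear_add)
  fix A assume "A \<in> sets (distr lborel borel f)"
  then have [measurable]: "A \<in> sets borel" by simp
  define B where "B = ball (0::'a) 1"
  have [measurable]: "B \<in> sets borel" by (simp add: B_def)
  have "emeasure (distr lborel borel f) A * emeasure lborel B =
      (\<integral>\<^sup>+y. (\<integral>\<^sup>+x. indicator A (f x) * indicator B y \<partial>lborel) \<partial>lborel)"
  proof -
    have "(\<integral>\<^sup>+x. indicator A (f x) \<partial>lborel) = emeasure (distr lborel borel f) A"
      by (subst nn_integral_distr[symmetric, where M' = borel]) simp_all
    then show ?thesis
      by (simp add: nn_integral_multc nn_integral_cmult)
  qed
  also have "\<dots> = (\<integral>\<^sup>+y. (\<integral>\<^sup>+x. indicator A (f x + y) * indicator B y \<partial>lborel) \<partial>lborel)"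
  proof (rule nn_integral_cong)
    fix y
    show "(\<integral>\<^sup>+x. indicator A (f x) * indicator B y \<partial>lborel) =
        (\<integral>\<^sup>+x. indicator A (f x + y) * indicator B y \<partial>lborel)"
      using nn_integral_lborel_add[of "\<lambda>x. indicator A (f x) * indicator B y" "g y"]
      by (simp add: f_add fg)
  qed
  also have "\<dots> = (\<integral>\<^sup>+x. (\<integral>\<^sup>+y. indicator A (f x + y) * indicator B y \<partial>lborel) \<partial>lborel)"
    by (rule lborel_pair.Fubini') simp
  also have "\<dots> = (\<integral>\<^sup>+x. (\<integral>\<^sup>+y. indicator A y * indicator B (y - f x) \<partial>lborel) \<partial>lborel)"
  proof (rule nn_integral_cong)
    fix x
    show "(\<integral>\<^sup>+y. indicator A (f x + y) * indicator B y \<partial>lborel) =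
        (\<integral>\<^sup>+y. indicator A y * indicator B (y - f x) \<partial>lborel)"
      using nn_integral_lborel_add[of "\<lambda>y. indicator A y * indicator B (y - f x)" "f x"]
      by (simp add: add.commute)
  qed
  also have "\<dots> = (\<integral>\<^sup>+y. (\<integral>\<^sup>+x. indicator A y * indicator B (y - f x) \<partial>lborel) \<partial>lborel)"
    by (rule lborel_pair.Fubini'[symmetric]) simp
  also have "\<dots> = (\<integral>\<^sup>+y. (\<integral>\<^sup>+x. indicator A y * indicator B x \<partial>lborel) \<partial>lborel)"
  proof (rule nn_integral_cong)
    fix y
    have "(\<integral>\<^sup>+x. indicator A y * indicator B (y - f x) \<partial>lborel) =
        (\<integral>\<^sup>+x. indicator A y * indicator B (- f x) \<partial>lborel)"
      using nn_integral_lborel_add[of "\<lambda>x. indicator A y * indicator B (y - f x)" "g y"]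
      by (simp add: f_add fg)
    also have "\<dots> = (\<integral>\<^sup>+x. indicator A y * indicator B x \<partial>lborel)"
      by (simp add: B_def indicator_def norm_f)
    finally show "(\<integral>\<^sup>+x. indicator A y * indicator B (y - f x) \<partial>lborel) =
        (\<integral>\<^sup>+x. indicator A y * indicator B x \<partial>lborel)" .
  qed
  also have "\<dots> = emeasure lborel A * emeasure lborel B"
    by (simp add: nn_integral_cmult nn_integral_multc)
  finally have *: "emeasure (distr lborel borel f) A * emeasure lborel B = emeasure lborel A * emeasure lborel B" .
  have "emeasure lborel B = ennreal (measure lborel B)"
    using emeasure_lborel_ball_finite[of "0::'a" 1]
    by (simp add: B_def emeasure_eq_ennreal_measure less_top)
  moreover have "measure lborel B > 0"
    using content_ball_pos[of 1 "0::'a"] by (simp add: B_def)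
  ultimately show "emeasure (distr lborel borel f) A = emeasure lborel A"
    using * by (simp add: mult_right_ennreal_cancel)
qed simp

definition perp :: "'a::real_inner \<Rightarrow> 'a \<Rightarrow> 'a" where
  "perp u x = x - (x \<bullet> u) *\<^sub>R u"

lemma perp_add: "perp u (x + y) = perp u x + perp u y"
  by (simp add: perp_def inner_left_distrib scaleR_left_distrib)

lemma perp_scaleR: "perp u (c *\<^sub>R x) = c *\<^sub>R perp u x"
  by (simp add: perp_def scaleR_right_diff_distrib)

lemma perp_inner [simp]: "norm u = 1 \<Longrightarrow> perp u x \<bullet> u = 0"
  by (simp add: perp_def inner_diff_left dot_square_norm)

lemma perp_axis [simp]: "norm u = 1 \<Longrightarrow> perp u (c *\<^sub>R u) = 0"
  by (simp add: perp_def dot_square_norm)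

lemma perp_id: "x \<bullet> u = 0 \<Longrightarrow> perp u x = x"
  by (simp add: perp_def)

lemma perp_decomp: "perp u x + (x \<bullet> u) *\<^sub>R u = x"
  by (simp add: perp_def)

lemma norm_add_axis:
  assumes "x \<bullet> u = 0" "norm u = 1"
  shows "(norm (x + r *\<^sub>R u))\<^sup>2 = (norm x)\<^sup>2 + r\<^sup>2"
proof -
  have "u \<bullet> u = 1" "u \<bullet> x = 0"
    using assms by (simp_all add: dot_square_norm inner_commute)
  then show ?thesis
    using assms(1) unfolding power2_norm_eq_inner
    by (simp add: inner_add_left inner_add_right power2_eq_square)
qed

lemma norm_perp:
  assumes "norm u = 1"
  shows "(norm x)\<^sup>2 = (norm (perp u x))\<^sup>2 + (x \<bullet> u)\<^sup>2"
  using norm_add_axis[of "perp u x" u "x \<bullet> u"] assms by (simp add: perp_decomp)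

lemma borel_measurable_perp [measurable]:
  fixes u :: "'a::euclidean_space"
  shows "perp u \<in> borel_measurable borel"
  unfolding perp_def[abs_def] by measurable

lemma nn_integral_swap_axis:
  fixes u :: "'a::euclidean_space"
  assumes u: "norm u = 1" and [measurable]: "F \<in> borel_measurable borel"
  shows "(\<integral>\<^sup>+x. \<integral>\<^sup>+r. F (x, r) \<partial>lborel \<partial>lborel) =
         (\<integral>\<^sup>+x. \<integral>\<^sup>+r. F (perp u x + r *\<^sub>R u, x \<bullet> u) \<partial>lborel \<partial>lborel)"
proof -
  define f :: "'a \<times> real \<Rightarrow> 'a \<times> real"
    where "f = (\<lambda>p. (perp u (fst p) + snd p *\<^sub>R u, fst p \<bullet> u))"
  have "norm (f p) = norm p" for p
  proof -
    have "(norm (f p))\<^sup>2 = (norm p)\<^sup>2"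
      using u norm_perp[OF u, of "fst p"]
      by (cases p) (simp add: f_def norm_Pair norm_add_axis)
    then show ?thesis by simp
  qed
  moreover have "linear f"
    by (rule linearI) (auto simp: f_def perp_add perp_scaleR algebra_simps)
  ultimately have f: "orthogonal_transformation f"
    by (simp add: orthogonal_transformation)
  have F: "F \<in> borel_measurable (lborel \<Otimes>\<^sub>M lborel)"
    by (simp add: lborel_prod)
  have f_m [measurable]: "f \<in> borel_measurable borel"
    using \<open>linear f\<close> by (intro borel_measurable_continuous_onI linear_continuous_on)
      (simp add: linear_conv_bounded_linear)
  have Ff: "(\<lambda>p. F (f p)) \<in> borel_measurable (lborel \<Otimes>\<^sub>M lborel)"
    by (simp add: lborel_prod)
  have "(\<integral>\<^sup>+x. \<integral>\<^sup>+r. F (x, r) \<partial>lborel \<partial>lborel) = (\<integral>\<^sup>+p. F p \<partial>lborel)"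
    using F by (subst lborel.nn_integral_fst) (simp_all add: lborel_prod)
  also have "\<dots> = (\<integral>\<^sup>+p. F p \<partial>distr lborel borel f)"
    by (simp only: lborel_distr_orthogonal_transformation[OF f])
  also have "\<dots> = (\<integral>\<^sup>+p. F (f p) \<partial>lborel)"
    by (simp add: nn_integral_distr)
  also have "\<dots> = (\<integral>\<^sup>+x. \<integral>\<^sup>+r. F (f (x, r)) \<partial>lborel \<partial>lborel)"
    by (subst lborel.nn_integral_fst[OF Ff]) (simp_all add: lborel_prod)
  finally show ?thesis
    by (simp add: f_def)
qed

subsection \<open>The standard Gaussian measure\<close>

definition gauss_density :: "'a::euclidean_space \<Rightarrow> real" where
  "gauss_density x = (1 / sqrt (2 * pi)) ^ DIM('a) * exp (- (norm x)\<^sup>2 / 2)"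

lemma gauss_density_pos: "gauss_density x > 0"
  by (simp add: gauss_density_def)

lemma borel_measurable_gauss_density [measurable]: "gauss_density \<in> borel_measurable borel"
  unfolding gauss_density_def by measurable

lemma prod_std_normal_density:
  fixes x :: "'a::euclidean_space"
  shows "(\<Prod>b\<in>Basis. std_normal_density (x \<bullet> b)) = gauss_density x"
proof -
  have "(norm x)\<^sup>2 = (\<Sum>b\<in>Basis. (x \<bullet> b)\<^sup>2)"
    by (subst power2_norm_eq_inner, subst euclidean_inner) (simp add: power2_eq_square)
  then show ?thesis
    by (simp add: gauss_density_def std_normal_density_def prod_dividef power_one_over
        sum_divide_distrib sum_negf flip: exp_sum)
qed

lemma std_gaussian_eq: "std_gaussian = density lborel (\<lambda>x. ennreal (gauss_density x))"
  by (simp add: std_gaussian_def prod_std_normal_density)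

lemma sets_std_gaussian [measurable_cong, simp]: "sets std_gaussian = sets borel"
  by (simp add: std_gaussian_def)

lemma space_std_gaussian [simp]: "space std_gaussian = UNIV"
  by (simp add: std_gaussian_def)

lemma nn_integral_std_gaussian:
  assumes [measurable]: "f \<in> borel_measurable borel"
  shows "(\<integral>\<^sup>+x. f x \<partial>std_gaussian) = (\<integral>\<^sup>+x. ennreal (gauss_density x) * f x \<partial>lborel)"
  by (simp add: std_gaussian_eq nn_integral_density)

lemma nn_integral_std_normal_density: "(\<integral>\<^sup>+r. ennreal (std_normal_density r) \<partial>lborel) = 1"
proof -
  interpret prob_space "density lborel std_normal_density"
    by (rule prob_space_normal_density) simp
  show ?thesis
    using emeasure_space_1 by (simp add: emeasure_density)
qed

lemma prob_space_std_gaussian: "prob_space (std_gaussian :: 'a::euclidean_space measure)"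
proof
  have "emeasure (std_gaussian :: 'a measure) UNIV =
      (\<integral>\<^sup>+x. (\<Prod>b\<in>Basis. ennreal (std_normal_density ((x::'a) \<bullet> b))) \<partial>lborel)"
    by (simp add: std_gaussian_def emeasure_density prod_ennreal)
  also have "\<dots> = 1"
    by (subst nn_integral_lborel_prod) (simp_all add: nn_integral_std_normal_density)
  finally show "emeasure (std_gaussian :: 'a measure) (space std_gaussian) = 1"
    by simp
qed

lemma gauss_density_swap:
  assumes "y \<bullet> u = 0" "norm u = 1"
  shows "gauss_density (y + r *\<^sub>R u) * std_normal_density q =
         gauss_density (y + q *\<^sub>R u) * std_normal_density r"
proof -
  have "exp (- ((norm y)\<^sup>2 + r\<^sup>2) / 2) * exp (- q\<^sup>2 / 2) =
      exp (- ((norm y)\<^sup>2 + q\<^sup>2) / 2) * exp (- r\<^sup>2 / 2)"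
    by (simp add: algebra_simps diff_divide_distrib flip: exp_add)
  then show ?thesis
    by (simp add: gauss_density_def std_normal_density_def norm_add_axis[OF assms])
qed

lemma gauss_perp_indep:
  fixes u :: "'a::euclidean_space" and A :: "'a \<Rightarrow> ennreal" and B :: "real \<Rightarrow> ennreal"
  assumes u: "norm u = 1"
    and [measurable]: "A \<in> borel_measurable borel" "B \<in> borel_measurable borel"
  shows "(\<integral>\<^sup>+x. A (perp u x) * B (x \<bullet> u) \<partial>std_gaussian) =
         (\<integral>\<^sup>+x. A (perp u x) \<partial>std_gaussian) * (\<integral>\<^sup>+r. ennreal (std_normal_density r) * B r \<partial>lborel)"
proof -
  define F where "F = (\<lambda>(x, r). ennreal (gauss_density x) * (A (perp u x) * B (x \<bullet> u)) *
    ennreal (std_normal_density r))"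
  have F_m: "F \<in> borel_measurable borel"
    unfolding F_def borel_prod[symmetric] by measurable
  have dens: "ennreal (gauss_density (perp u x + r *\<^sub>R u)) * ennreal (std_normal_density (x \<bullet> u)) =
      ennreal (gauss_density x) * ennreal (std_normal_density r)" for x r
    using gauss_density_swap[of "perp u x" u r "x \<bullet> u"] u
    by (simp add: perp_decomp flip: ennreal_mult'')
  have "(\<integral>\<^sup>+x. A (perp u x) * B (x \<bullet> u) \<partial>std_gaussian) = (\<integral>\<^sup>+x. \<integral>\<^sup>+r. F (x, r) \<partial>lborel \<partial>lborel)"
    by (simp add: F_def nn_integral_std_gaussian nn_integral_cmult nn_integral_std_normal_density)
  also have "\<dots> = (\<integral>\<^sup>+x. \<integral>\<^sup>+r. F (perp u x + r *\<^sub>R u, x \<bullet> u) \<partial>lborel \<partial>lborel)"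
    by (rule nn_integral_swap_axis[OF u F_m])
  also have "\<dots> = (\<integral>\<^sup>+x. \<integral>\<^sup>+r. (ennreal (gauss_density x) * A (perp u x)) *
      (ennreal (std_normal_density r) * B r) \<partial>lborel \<partial>lborel)"
  proof (intro nn_integral_cong)
    fix x r
    have "F (perp u x + r *\<^sub>R u, x \<bullet> u) =
        (ennreal (gauss_density (perp u x + r *\<^sub>R u)) * ennreal (std_normal_density (x \<bullet> u))) *
        (A (perp u x) * B r)"
      using u by (simp add: F_def perp_add perp_id inner_add_left dot_square_norm mult_ac)
    then show "F (perp u x + r *\<^sub>R u, x \<bullet> u) =
        (ennreal (gauss_density x) * A (perp u x)) * (ennreal (std_normal_density r) * B r)"
      unfolding dens by (simp add: mult_ac)
  qed
  also have "\<dots> = (\<integral>\<^sup>+x. A (perp u x) \<partial>std_gaussian) *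
      (\<integral>\<^sup>+r. ennreal (std_normal_density r) * B r \<partial>lborel)"
    by (simp add: nn_integral_cmult nn_integral_multc nn_integral_std_gaussian)
  finally show ?thesis .
qed

lemma nn_integral_std_normal_square_exp:
  assumes "b > 0"
  shows "(\<integral>\<^sup>+r. ennreal (std_normal_density r) * ennreal (exp ((1 - b\<^sup>2) * r\<^sup>2 / 2)) \<partial>lborel) =
         ennreal (1 / b)"
proof -
  have "std_normal_density r * exp ((1 - b\<^sup>2) * r\<^sup>2 / 2) = std_normal_density (b *\<^sub>R r)" for r
    by (simp add: std_normal_density_def algebra_simps power_mult_distrib diff_divide_distrib
        flip: exp_add)
  then have "(\<integral>\<^sup>+r. ennreal (std_normal_density r) * ennreal (exp ((1 - b\<^sup>2) * r\<^sup>2 / 2)) \<partial>lborel) =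
      (\<integral>\<^sup>+r. ennreal (std_normal_density (b *\<^sub>R r)) \<partial>lborel)"
    by (simp flip: ennreal_mult'')
  also have "\<dots> = ennreal (1 / b)"
    using assms by (subst nn_integral_lborel_scale) (simp_all add: nn_integral_std_normal_density)
  finally show ?thesis .
qed

text \<open>
  The moment generating function of a chi-square variable with \<open>DIM('a) - 1\<close> degrees of freedom,
  restricted to a cone: rescaling space by \<open>b\<close> gives it in all directions, and the
  independent coordinate along \<open>u\<close> is then divided out.
\<close>

lemma gauss_cone_square_exp:
  fixes u :: "'a::euclidean_space"
  assumes u: "norm u = 1" and K [measurable]: "K \<in> sets borel" and b: "b > 0"
    and cone: "\<And>c x. c > 0 \<Longrightarrow> x \<in> K \<Longrightarrow> c *\<^sub>R x \<in> K"
  shows "(\<integral>\<^sup>+x. indicator K (perp u x) * ennreal (exp ((1 - b\<^sup>2) * (norm (perp u x))\<^sup>2 / 2)) \<partial>std_gaussian) =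
         ennreal ((1 / b) ^ (DIM('a) - 1)) * emeasure std_gaussian {x. perp u x \<in> K}"
    (is "?I = _ * ?G")
proof -
  have G: "?G = (\<integral>\<^sup>+x. ennreal (gauss_density x) * indicator K (perp u x) \<partial>lborel)"
    by (simp add: std_gaussian_eq emeasure_density indicator_def cong: if_cong)
  have K_iff: "b *\<^sub>R x \<in> K \<longleftrightarrow> x \<in> K" for x
    using cone[of b x] cone[of "1 / b" "b *\<^sub>R x"] b by auto
  have split: "exp ((1 - b\<^sup>2) * (norm x)\<^sup>2 / 2) =
      exp ((1 - b\<^sup>2) * (norm (perp u x))\<^sup>2 / 2) * exp ((1 - b\<^sup>2) * (x \<bullet> u)\<^sup>2 / 2)" for x
    by (subst norm_perp[OF u]) (simp add: ring_distribs add_divide_distrib flip: exp_add)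
  have dens: "gauss_density x * exp ((1 - b\<^sup>2) * (norm x)\<^sup>2 / 2) = gauss_density (b *\<^sub>R x)" for x :: 'a
    by (simp add: gauss_density_def algebra_simps power_mult_distrib diff_divide_distrib
        flip: exp_add)
  have "?I * ennreal (1 / b) =
      (\<integral>\<^sup>+x. indicator K (perp u x) * ennreal (exp ((1 - b\<^sup>2) * (norm (perp u x))\<^sup>2 / 2)) *
        ennreal (exp ((1 - b\<^sup>2) * (x \<bullet> u)\<^sup>2 / 2)) \<partial>std_gaussian)"
    using gauss_perp_indep[OF u, of "\<lambda>y. indicator K y * ennreal (exp ((1 - b\<^sup>2) * (norm y)\<^sup>2 / 2))"
        "\<lambda>r. ennreal (exp ((1 - b\<^sup>2) * r\<^sup>2 / 2))"]
    by (simp add: nn_integral_std_normal_square_exp[OF b])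
  also have "\<dots> = (\<integral>\<^sup>+x. indicator K (perp u x) * ennreal (exp ((1 - b\<^sup>2) * (norm x)\<^sup>2 / 2)) \<partial>std_gaussian)"
    by (simp add: mult.assoc flip: split ennreal_mult'')
  also have "\<dots> = (\<integral>\<^sup>+x. ennreal (gauss_density (b *\<^sub>R x)) * indicator K (perp u (b *\<^sub>R x)) \<partial>lborel)"
    by (subst nn_integral_std_gaussian, measurable)
      (simp add: perp_scaleR dens[symmetric] ennreal_mult' less_imp_le[OF gauss_density_pos]
        indicator_def K_iff mult_ac cong: if_cong)
  also have "\<dots> = ennreal ((1 / b) ^ DIM('a)) * ?G"
    unfolding G
    by (rule nn_integral_lborel_scale[OF _ b, of "\<lambda>x. ennreal (gauss_density x) * indicator K (perp u x)"])
      measurable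
  also have "\<dots> = (ennreal ((1 / b) ^ (DIM('a) - 1)) * ?G) * ennreal (1 / b)"
  proof -
    have "ennreal ((1 / b) ^ (DIM('a) - 1)) * ennreal (1 / b) =
        ennreal ((1 / b) ^ (DIM('a) - 1) * (1 / b))"
      using b by (subst ennreal_mult'') simp_all
    also have "\<dots> = ennreal ((1 / b) ^ DIM('a))"
      by (subst power_minus_mult) simp_all
    finally have pow: "ennreal ((1 / b) ^ (DIM('a) - 1)) * ennreal (1 / b) = ennreal ((1 / b) ^ DIM('a))" .
    show ?thesis
      unfolding pow[symmetric] by (simp only: mult_ac)
  qed
  finally show ?thesis
    using b by (simp add: mult_right_ennreal_cancel)
qed

lemma gauss_sheared_slab:
  fixes u w :: "'a::euclidean_space"
  assumes u: "norm u = 1" and K [measurable]: "K \<in> sets borel" and pos: "u \<bullet> w > 0"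
  defines "h \<equiv> u \<bullet> w"
  shows "emeasure std_gaussian {y. u \<bullet> y \<in> {0..<h} \<and> y - (u \<bullet> y / h) *\<^sub>R w \<in> K} =
    (\<integral>\<^sup>+r. indicator {0..<h} r * (\<integral>\<^sup>+x. indicator K (perp u x) *
      ennreal (1 / sqrt (2 * pi) * exp (- (r / h) * (perp u x \<bullet> w) - (r / h)\<^sup>2 * (norm w)\<^sup>2 / 2))
      \<partial>std_gaussian) \<partial>lborel)"
    (is "emeasure _ ?P = _")
proof -
  have P [measurable]: "?P \<in> sets borel"
    by measurable
  define F :: "'a \<times> real \<Rightarrow> ennreal"
    where "F = (\<lambda>(y, q). ennreal (gauss_density y) * indicator ?P y * ennreal (std_normal_density q))"
  have F_m [measurable]: "F \<in> borel_measurable borel"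
    unfolding F_def borel_prod[symmetric] by measurable
  have F_m' [measurable]: "F \<in> borel_measurable (borel \<Otimes>\<^sub>M borel)"
    by (simp add: borel_prod)
  define E where "E = (\<lambda>r x. indicator K (perp u x) *
      ennreal (1 / sqrt (2 * pi) * exp (- (r / h) * (perp u x \<bullet> w) - (r / h)\<^sup>2 * (norm w)\<^sup>2 / 2)))"
  have [measurable]: "E r \<in> borel_measurable borel" for r
    unfolding E_def by measurable
  have "emeasure std_gaussian ?P = (\<integral>\<^sup>+x. \<integral>\<^sup>+r. F (x, r) \<partial>lborel \<partial>lborel)"
    by (simp add: F_def std_gaussian_eq emeasure_density nn_integral_cmult nn_integral_std_normal_density)
  also have "\<dots> = (\<integral>\<^sup>+x. \<integral>\<^sup>+r. F (perp u x + r *\<^sub>R u, x \<bullet> u) \<partial>lborel \<partial>lborel)"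
    by (rule nn_integral_swap_axis[OF u F_m])
  also have "\<dots> = (\<integral>\<^sup>+r. \<integral>\<^sup>+x. F (perp u x + r *\<^sub>R u, x \<bullet> u) \<partial>lborel \<partial>lborel)"
    by (rule lborel_pair.Fubini'[symmetric]) simp
  also have "\<dots> = (\<integral>\<^sup>+r. indicator {0..<h} r * (\<integral>\<^sup>+x. E r x \<partial>std_gaussian) \<partial>lborel)"
  proof (intro nn_integral_cong)
    fix r :: real
    define v where "v = (r / h) *\<^sub>R w - r *\<^sub>R u"
    have "u \<bullet> u = 1"
      using u by (simp add: dot_square_norm)
    then have "v \<bullet> u = 0"
      using pos by (simp add: v_def h_def inner_diff_left inner_diff_right inner_commute)
    then have v: "perp u (x + v) + r *\<^sub>R u = perp u x + (r / h) *\<^sub>R w" "(x + v) \<bullet> u = x \<bullet> u" for x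
      by (simp_all add: perp_add perp_id v_def inner_add_left)
    have "(\<integral>\<^sup>+x. F (perp u x + r *\<^sub>R u, x \<bullet> u) \<partial>lborel) =
        (\<integral>\<^sup>+x. F (perp u x + (r / h) *\<^sub>R w, x \<bullet> u) \<partial>lborel)"
      using nn_integral_lborel_add[of "\<lambda>x. F (perp u x + r *\<^sub>R u, x \<bullet> u)" v]
      by (simp add: v)
    also have "\<dots> = (\<integral>\<^sup>+x. indicator {0..<h} r * (ennreal (gauss_density x) * E r x) \<partial>lborel)"
    proof (intro nn_integral_cong)
      fix x
      define y where "y = perp u x + (r / h) *\<^sub>R w"
      have "u \<bullet> y = r"
        using pos u perp_inner[OF u, of x]
        by (simp add: y_def h_def inner_add_right inner_commute)
      then have ind: "indicator ?P y = (indicator {0..<h} r * indicator K (perp u x) :: ennreal)"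
        by (auto simp: indicator_def y_def)
      have "(norm y)\<^sup>2 = (norm (perp u x))\<^sup>2 + 2 * (r / h) * (perp u x \<bullet> w) + (r / h)\<^sup>2 * (norm w)\<^sup>2"
        unfolding y_def power2_norm_eq_inner
        by (simp add: inner_add_left inner_add_right inner_commute power2_eq_square)
      then have "gauss_density y * std_normal_density (x \<bullet> u) = gauss_density x *
          (1 / sqrt (2 * pi) * exp (- (r / h) * (perp u x \<bullet> w) - (r / h)\<^sup>2 * (norm w)\<^sup>2 / 2))"
        unfolding gauss_density_def std_normal_density_def norm_perp[OF u, of x]
        by (simp add: field_simps flip: exp_add)
      then have "ennreal (gauss_density y) * ennreal (std_normal_density (x \<bullet> u)) =
          ennreal (gauss_density x) * ennreal
          (1 / sqrt (2 * pi) * exp (- (r / h) * (perp u x \<bullet> w) - (r / h)\<^sup>2 * (norm w)\<^sup>2 / 2))"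
        by (simp add: less_imp_le[OF gauss_density_pos] flip: ennreal_mult)
      moreover have "F (y, x \<bullet> u) = (ennreal (gauss_density y) * ennreal (std_normal_density (x \<bullet> u))) *
          (indicator {0..<h} r * indicator K (perp u x))"
        by (simp only: F_def prod.case ind mult_ac)
      ultimately show "F (perp u x + (r / h) *\<^sub>R w, x \<bullet> u) =
          indicator {0..<h} r * (ennreal (gauss_density x) * E r x)"
        unfolding y_def[symmetric] by (simp add: E_def mult_ac)
    qed
    also have "\<dots> = indicator {0..<h} r * (\<integral>\<^sup>+x. E r x \<partial>std_gaussian)"
      by (simp add: nn_integral_cmult nn_integral_std_gaussian)
    finally show "(\<integral>\<^sup>+x. F (perp u x + r *\<^sub>R u, x \<bullet> u) \<partial>lborel) =
        indicator {0..<h} r * (\<integral>\<^sup>+x. E r x \<partial>std_gaussian)" .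
  qed
  finally show ?thesis
    unfolding E_def .
qed

subsection \<open>Exponential moments on cones\<close>

lemma ln_le_chi_rate:
  fixes x :: real
  assumes "x \<ge> 1"
  shows "ln x \<le> x - 1 / x - (1 - 1 / x\<^sup>2) / 2"
proof -
  define g where "g = (\<lambda>x::real. x - 1 / x - (1 - 1 / x\<^sup>2) / 2 - ln x)"
  have "g 1 \<le> g x"
  proof (rule DERIV_nonneg_imp_nondecreasing[OF assms])
    fix z :: real
    assume "1 \<le> z" "z \<le> x"
    then have "(g has_real_derivative (z - 1) * (z\<^sup>2 + 1) / z ^ 3) (at z)"
      unfolding g_def
      by (auto intro!: derivative_eq_intros simp: field_simps power2_eq_square power3_eq_cube
          power4_eq_xxxx)
    then show "\<exists>y. (g has_real_derivative y) (at z) \<and> 0 \<le> y"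
      using \<open>1 \<le> z\<close> by (intro exI[of _ "(z - 1) * (z\<^sup>2 + 1) / z ^ 3"]) auto
  qed
  then show ?thesis
    by (simp add: g_def)
qed

lemma perp_eq_0:
  fixes u :: "'a::euclidean_space"
  assumes "norm u = 1" "DIM('a) = 1"
  shows "perp u x = 0"
proof -
  have "dim {y. u \<bullet> y = 0} = 0"
    using assms by (subst dim_hyperplane) auto
  then have "{y. u \<bullet> y = 0} \<subseteq> {0}"
    by (simp add: dim_eq_0)
  moreover have "u \<bullet> perp u x = 0"
    using assms by (metis inner_commute perp_inner)
  ultimately show ?thesis
    by blast
qed

lemma emeasure_perp_vimage:
  assumes [measurable]: "K \<in> sets borel"
  shows "emeasure std_gaussian {x. perp u x \<in> K} = (\<integral>\<^sup>+x. indicator K (perp u x) \<partial>std_gaussian)"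
proof -
  have "(\<integral>\<^sup>+x. indicator K (perp u x) \<partial>std_gaussian) =
      (\<integral>\<^sup>+x. indicator {x. perp u x \<in> K} x \<partial>std_gaussian)"
    by (simp add: indicator_def)
  then show ?thesis
    by simp
qed

lemma gauss_cone_exp_upper:
  fixes u :: "'a::euclidean_space"
  assumes u: "norm u = 1" and K [measurable]: "K \<in> sets borel" and a: "a \<ge> 0"
    and cone: "\<And>c x. c > 0 \<Longrightarrow> x \<in> K \<Longrightarrow> c *\<^sub>R x \<in> K"
  shows "(\<integral>\<^sup>+x. indicator K (perp u x) * ennreal (exp (a * norm (perp u x) - a\<^sup>2 / 2)) \<partial>std_gaussian) \<le>
         ennreal (exp (sqrt (real (DIM('a) - 1)) * a)) * emeasure std_gaussian {x. perp u x \<in> K}"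
    (is "?I \<le> ennreal (exp (sqrt (real ?d) * a)) * ?G")
proof (cases "?d = 0")
  case True
  then have "DIM('a) = 1"
    by (metis DIM_positive One_nat_def Suc_pred)
  then have "perp u x = 0" for x
    using u by (simp add: perp_eq_0)
  then have "?I \<le> (\<integral>\<^sup>+x. indicator K (perp u x) \<partial>std_gaussian)"
    by (intro nn_integral_mono) (simp add: indicator_def)
  then show ?thesis
    using True by (simp add: emeasure_perp_vimage)
next
  case False
  define D where "D = sqrt (real ?d)"
  have D: "D > 0" "D\<^sup>2 = real ?d"
    using False by (simp_all add: D_def)
  define x where "x = (a / D + sqrt ((a / D)\<^sup>2 + 4)) / 2"
  have "sqrt ((a / D)\<^sup>2 + 4) \<ge> sqrt 4"
    by (subst real_sqrt_le_iff) simp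
  moreover have "a / D \<ge> 0"
    using a D by simp
  ultimately have x1: "x \<ge> 1"
    by (simp add: x_def)
  have "2 * x = a / D + sqrt ((a / D)\<^sup>2 + 4)"
    by (simp add: x_def)
  then have "(2 * x - a / D)\<^sup>2 = (a / D)\<^sup>2 + 4"
    by simp
  moreover have "x\<^sup>2 - x * y = 1" if "(2 * x - y)\<^sup>2 = y\<^sup>2 + 4" for y
    using that by (simp add: power2_eq_square algebra_simps)
  ultimately have "x\<^sup>2 - x * (a / D) = 1"
    by blast
  then have ax: "a = D * (x - 1 / x)"
    using D x1 by (simp add: field_simps power2_eq_square)
  have pointwise: "exp (a * r - a\<^sup>2 / 2) \<le>
      exp (D\<^sup>2 * (x\<^sup>2 - 1) / 2 - a\<^sup>2 / 2) * exp ((1 - (1 / x)\<^sup>2) * r\<^sup>2 / 2)" for r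
  proof -
    have "0 \<le> (x\<^sup>2 - 1) / 2 * (r / x - D)\<^sup>2"
      using x1 by (intro mult_nonneg_nonneg) auto
    also have "\<dots> = D\<^sup>2 * (x\<^sup>2 - 1) / 2 + (1 - (1 / x)\<^sup>2) * r\<^sup>2 / 2 - a * r"
      using x1 unfolding ax by (simp add: field_simps power2_eq_square)
    finally show ?thesis
      by (simp flip: exp_add)
  qed
  have "?I \<le> (\<integral>\<^sup>+x'. ennreal (exp (D\<^sup>2 * (x\<^sup>2 - 1) / 2 - a\<^sup>2 / 2)) *
      (indicator K (perp u x') * ennreal (exp ((1 - (1 / x)\<^sup>2) * (norm (perp u x'))\<^sup>2 / 2))) \<partial>std_gaussian)"
    using pointwise
    by (intro nn_integral_mono) (auto simp: indicator_def simp flip: ennreal_mult'')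
  also have "\<dots> = ennreal (exp (D\<^sup>2 * (x\<^sup>2 - 1) / 2 - a\<^sup>2 / 2)) * (ennreal ((1 / (1 / x)) ^ ?d) * ?G)"
    using x1 gauss_cone_square_exp[OF u K _ cone, of "1 / x"]
    by (subst nn_integral_cmult; simp)
  also have "\<dots> = ennreal (exp (D\<^sup>2 * (x\<^sup>2 - 1) / 2 - a\<^sup>2 / 2) * x ^ ?d) * ?G"
    using x1 by (simp add: ennreal_mult mult.assoc)
  also have "\<dots> \<le> ennreal (exp (D * a)) * ?G"
  proof (intro mult_right_mono ennreal_leI)
    have "x ^ ?d = exp (D\<^sup>2 * ln x)"
      unfolding D(2) using x1 by (simp only: exp_of_nat_mult) simp
    then have "exp (D\<^sup>2 * (x\<^sup>2 - 1) / 2 - a\<^sup>2 / 2) * x ^ ?d =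
        exp (D\<^sup>2 * (ln x + (x\<^sup>2 - 1) / 2 - (x - 1 / x)\<^sup>2 / 2))"
      unfolding ax power_mult_distrib by (simp add: algebra_simps diff_divide_distrib flip: exp_add)
    also have "(x - 1 / x)\<^sup>2 = x\<^sup>2 - 2 + 1 / x\<^sup>2"
      using x1 by (simp add: power2_eq_square field_simps)
    also have "exp (D\<^sup>2 * (ln x + (x\<^sup>2 - 1) / 2 - (x\<^sup>2 - 2 + 1 / x\<^sup>2) / 2)) \<le> exp (D\<^sup>2 * (x - 1 / x))"
    proof -
      have "ln x + (x\<^sup>2 - 1) / 2 - (x\<^sup>2 - 2 + 1 / x\<^sup>2) / 2 \<le> x - 1 / x"
        using ln_le_chi_rate[OF x1] by argo
      then show ?thesis
        by (simp only: exp_le_cancel_iff) (rule mult_left_mono, simp_all)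
    qed
    also have "D\<^sup>2 * (x - 1 / x) = D * a"
      unfolding ax by (simp add: power2_eq_square)
    finally show "exp (D\<^sup>2 * (x\<^sup>2 - 1) / 2 - a\<^sup>2 / 2) * x ^ ?d \<le> exp (D * a)" .
  qed simp
  finally show ?thesis
    by (simp add: D_def)
qed

lemma gauss_cone_exp_lower:
  fixes u :: "'a::euclidean_space"
  assumes u: "norm u = 1" and K [measurable]: "K \<in> sets borel" and a: "a \<ge> 0"
    and cone: "\<And>c x. c > 0 \<Longrightarrow> x \<in> K \<Longrightarrow> c *\<^sub>R x \<in> K"
  shows "ennreal (exp (- (sqrt (real (DIM('a) - 1)) * a))) * emeasure std_gaussian {x. perp u x \<in> K} \<le>
         (\<integral>\<^sup>+x. indicator K (perp u x) * ennreal (exp (- (a * norm (perp u x)))) \<partial>std_gaussian)"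
    (is "ennreal (exp (- (sqrt (real ?d) * a))) * ?G \<le> ?I")
proof (cases "?d = 0")
  case True
  then have "DIM('a) = 1"
    by (metis DIM_positive One_nat_def Suc_pred)
  then have "perp u x = 0" for x
    using u by (simp add: perp_eq_0)
  then show ?thesis
    using True by (simp add: emeasure_perp_vimage)
next
  case False
  define D where "D = sqrt (real ?d)"
  have D: "D > 0" "D\<^sup>2 = real ?d"
    using False by (simp_all add: D_def)
  define b where "b = sqrt (1 + a / D)"
  have b: "b > 0" "b\<^sup>2 = 1 + a / D"
    using a D by (simp_all add: b_def add_pos_nonneg)
  have pointwise: "exp (- (a * D / 2)) * exp ((1 - b\<^sup>2) * r\<^sup>2 / 2) \<le> exp (- (a * r))" for r
  proof -
    have "0 \<le> a / (2 * D) * (r - D)\<^sup>2"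
      using a D by simp
    also have "\<dots> = a * D / 2 + a / D * r\<^sup>2 / 2 - a * r"
      using D by (simp add: field_simps power2_eq_square)
    finally show ?thesis
      by (simp add: b(2) flip: exp_add)
  qed
  have "exp (- (D * a)) \<le> exp (- (a * D / 2)) * (1 / b) ^ ?d"
  proof -
    have "b\<^sup>2 \<le> exp (a / D)"
      unfolding b(2) by (rule exp_ge_add_one_self)
    also have "\<dots> = (exp (a / (2 * D)))\<^sup>2"
      by (simp add: power2_eq_square flip: exp_add)
    finally have "b \<le> exp (a / (2 * D))"
      by (rule power2_le_imp_le) simp
    then have "b ^ ?d \<le> exp (a / (2 * D)) ^ ?d"
      using b by (intro power_mono) auto
    also have "\<dots> = exp (D\<^sup>2 * (a / (2 * D)))"
      unfolding D(2) by (rule exp_of_nat_mult[symmetric])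
    also have "D\<^sup>2 * (a / (2 * D)) = a * D / 2"
      using D(1) by (simp add: power2_eq_square field_simps)
    finally have "exp (- (a * D / 2)) \<le> (1 / b) ^ ?d"
      using b(1) by (simp add: exp_minus power_one_over field_simps)
    then have "exp (- (a * D / 2)) * exp (- (a * D / 2)) \<le> exp (- (a * D / 2)) * (1 / b) ^ ?d"
      by (intro mult_left_mono) auto
    then show ?thesis
      by (simp add: mult.commute flip: exp_add)
  qed
  then have "ennreal (exp (- (D * a))) * ?G \<le> ennreal (exp (- (a * D / 2)) * (1 / b) ^ ?d) * ?G"
    by (intro mult_right_mono ennreal_leI) auto
  also have "\<dots> = ennreal (exp (- (a * D / 2))) * (ennreal ((1 / b) ^ ?d) * ?G)"
    using b by (simp add: ennreal_mult mult.assoc)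
  also have "\<dots> = (\<integral>\<^sup>+x. ennreal (exp (- (a * D / 2))) *
      (indicator K (perp u x) * ennreal (exp ((1 - b\<^sup>2) * (norm (perp u x))\<^sup>2 / 2))) \<partial>std_gaussian)"
    using gauss_cone_square_exp[OF u K b(1) cone] by (subst nn_integral_cmult; simp)
  also have "\<dots> \<le> ?I"
    using pointwise
    by (intro nn_integral_mono) (auto simp: indicator_def simp flip: ennreal_mult'')
  finally show ?thesis
    by (simp add: D_def)
qed

lemma gauss_sheared_slab_bounds:
  fixes u w :: "'a::euclidean_space"
  assumes u: "norm u = 1" and K [measurable]: "K \<in> sets borel" and pos: "u \<bullet> w > 0"
    and cone: "\<And>c x. c > 0 \<Longrightarrow> x \<in> K \<Longrightarrow> c *\<^sub>R x \<in> K"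
  defines "h \<equiv> u \<bullet> w" and "D \<equiv> sqrt (real (DIM('a) - 1))"
    and "G \<equiv> measure std_gaussian {x. perp u x \<in> K}"
  defines "P \<equiv> {y. u \<bullet> y \<in> {0..<h} \<and> y - (u \<bullet> y / h) *\<^sub>R w \<in> K}"
  shows "measure std_gaussian P \<le> 1 / sqrt (2 * pi) * (G * h) * exp (D * norm w)"
    and "measure std_gaussian P \<ge>
      1 / sqrt (2 * pi) * (G * h) * exp (- (D * norm w) - 1 / 2 * (norm w)\<^sup>2)"
proof -
  interpret prob_space "std_gaussian :: 'a measure"
    by (rule prob_space_std_gaussian)
  define c where "c = 1 / sqrt (2 * pi)"
  have c: "c \<ge> 0"
    by (simp add: c_def)
  have h: "h > 0"
    using pos by (simp add: h_def)
  have D: "D \<ge> 0"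
    by (simp add: D_def)
  have G: "emeasure std_gaussian {x. perp u x \<in> K} = ennreal G" "G \<ge> 0"
    by (simp_all add: G_def emeasure_eq_measure)
  define J where "J = (\<lambda>r. \<integral>\<^sup>+x. indicator K (perp u x) *
    ennreal (c * exp (- (r / h) * (perp u x \<bullet> w) - (r / h)\<^sup>2 * (norm w)\<^sup>2 / 2)) \<partial>std_gaussian)"
  have P: "ennreal (measure std_gaussian P) = (\<integral>\<^sup>+r. indicator {0..<h} r * J r \<partial>lborel)"
    unfolding J_def c_def P_def h_def emeasure_eq_measure[symmetric]
    by (rule gauss_sheared_slab[OF u K pos])
  have const: "(\<integral>\<^sup>+r. indicator {0..<h} r * ennreal M \<partial>lborel) = ennreal (M * h)" if "M \<ge> 0" for M
    using h that unfolding mult.commute[of "indicator _ _"]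
    by (simp add: nn_integral_cmult_indicator ennreal_mult)
  have inner_bounds: "- t * (perp u x \<bullet> w) \<le> t * norm w * norm (perp u x)"
    "- (t * norm w * norm (perp u x)) \<le> - t * (perp u x \<bullet> w)" if "t \<ge> 0" for t x
  proof -
    have "\<bar>t * (perp u x \<bullet> w)\<bar> \<le> t * norm w * norm (perp u x)"
      using mult_left_mono[OF Cauchy_Schwarz_ineq2[of "perp u x" w] that] that
      by (simp add: abs_mult mult_ac)
    then show "- t * (perp u x \<bullet> w) \<le> t * norm w * norm (perp u x)"
      "- (t * norm w * norm (perp u x)) \<le> - t * (perp u x \<bullet> w)"
      by linarith+
  qed
  have J_upper: "J r \<le> ennreal (c * G * exp (D * norm w))" if r: "r \<in> {0..<h}" for r
  proof -
    define t where "t = r / h"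
    have t: "0 \<le> t" "t \<le> 1"
      using r by (auto simp: t_def)
    have pw: "- t * (perp u x \<bullet> w) - t\<^sup>2 * (norm w)\<^sup>2 / 2 \<le>
        t * norm w * norm (perp u x) - (t * norm w)\<^sup>2 / 2" for x
      using inner_bounds(1)[OF t(1), of x] by (simp add: power_mult_distrib)
    have "J r \<le> (\<integral>\<^sup>+x. ennreal c * (indicator K (perp u x) *
        ennreal (exp (t * norm w * norm (perp u x) - (t * norm w)\<^sup>2 / 2))) \<partial>std_gaussian)"
      unfolding J_def t_def[symmetric] using pw c
      by (intro nn_integral_mono)
        (auto simp: indicator_def intro!: ennreal_leI mult_left_mono simp flip: ennreal_mult'')
    also have "\<dots> \<le> ennreal c * (ennreal (exp (D * (t * norm w))) * ennreal G)"
      using gauss_cone_exp_upper[OF u K _ cone, of "t * norm w"] t unfolding G D_def[symmetric]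
      by (subst nn_integral_cmult, measurable) (auto intro: mult_left_mono)
    also have "\<dots> = ennreal (c * G * exp (D * (t * norm w)))"
      using c G by (simp add: ennreal_mult mult_ac)
    also have "\<dots> \<le> ennreal (c * G * exp (D * norm w))"
      using t c G D by (intro ennreal_leI mult_left_mono) (auto intro!: mult_left_mono mult_left_le_one_le)
    finally show ?thesis .
  qed
  have J_lower: "ennreal (c * G * exp (- (D * norm w) - 1 / 2 * (norm w)\<^sup>2)) \<le> J r"
    if r: "r \<in> {0..<h}" for r
  proof -
    define t where "t = r / h"
    have t: "0 \<le> t" "t \<le> 1"
      using r by (auto simp: t_def)
    have t2: "t\<^sup>2 * (norm w)\<^sup>2 / 2 \<le> (norm w)\<^sup>2 / 2"
      using t by (simp add: mult_left_le_one_le power_le_one)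
    have pw: "- (norm w)\<^sup>2 / 2 + - (t * norm w * norm (perp u x)) \<le>
        - t * (perp u x \<bullet> w) - t\<^sup>2 * (norm w)\<^sup>2 / 2" for x
      using inner_bounds(2)[OF t(1), of x] t2 by simp
    have "ennreal (c * G * exp (- (D * norm w) - 1 / 2 * (norm w)\<^sup>2)) \<le>
        ennreal (c * G * exp (- (D * (t * norm w)) - 1 / 2 * (norm w)\<^sup>2))"
      using t c G D by (intro ennreal_leI mult_left_mono) (auto intro!: mult_left_mono mult_left_le_one_le)
    also have "\<dots> = ennreal (c * exp (- (norm w)\<^sup>2 / 2)) * (ennreal (exp (- (D * (t * norm w)))) * ennreal G)"
      using c G by (simp add: mult_ac flip: ennreal_mult'' exp_add)
    also have "\<dots> \<le> (\<integral>\<^sup>+x. ennreal (c * exp (- (norm w)\<^sup>2 / 2)) * (indicator K (perp u x) *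
        ennreal (exp (- (t * norm w * norm (perp u x))))) \<partial>std_gaussian)"
      using gauss_cone_exp_lower[OF u K _ cone, of "t * norm w"] t unfolding G D_def[symmetric]
      by (subst nn_integral_cmult, measurable) (auto intro: mult_left_mono)
    also have "\<dots> \<le> J r"
      unfolding J_def t_def[symmetric] using pw c
      by (intro nn_integral_mono)
        (auto simp: indicator_def mult.assoc intro!: ennreal_leI mult_left_mono simp flip: ennreal_mult'' exp_add)
    finally show ?thesis .
  qed
  have "ennreal (measure std_gaussian P) \<le> (\<integral>\<^sup>+r. indicator {0..<h} r * ennreal (c * G * exp (D * norm w)) \<partial>lborel)"
    unfolding P using J_upper by (intro nn_integral_mono) (auto simp: indicator_def)
  also have "\<dots> = ennreal (c * G * exp (D * norm w) * h)"
    using c G by (intro const) auto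
  finally show "measure std_gaussian P \<le> 1 / sqrt (2 * pi) * (G * h) * exp (D * norm w)"
    using c G h by (subst (asm) ennreal_le_iff) (simp_all add: c_def mult_ac)
  have "ennreal (c * G * exp (- (D * norm w) - 1 / 2 * (norm w)\<^sup>2) * h) =
      (\<integral>\<^sup>+r. indicator {0..<h} r * ennreal (c * G * exp (- (D * norm w) - 1 / 2 * (norm w)\<^sup>2)) \<partial>lborel)"
    using c G by (intro const[symmetric]) auto
  also have "\<dots> \<le> ennreal (measure std_gaussian P)"
    unfolding P using J_lower by (intro nn_integral_mono) (auto simp: indicator_def)
  finally show "measure std_gaussian P \<ge>
      1 / sqrt (2 * pi) * (G * h) * exp (- (D * norm w) - 1 / 2 * (norm w)\<^sup>2)"
    by (subst (asm) ennreal_le_iff) (simp_all add: c_def mult_ac)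
qed

subsection \<open>Decomposition of the margin\<close>

lemma orth_proj_hyperplane:
  assumes "norm u = 1"
  shows "orth_proj {y. u \<bullet> y = 0} x = perp u x"
  unfolding orth_proj_def
  by (rule the1_equality[OF orth_proj_ex1[OF subspace_hyperplane]])
    (use assms in \<open>auto simp: perp_def orthogonal_def inner_diff_right inner_commute dot_square_norm\<close>)

lemma span_cone_facet:
  fixes T :: "'a::euclidean_space set"
  assumes T: "polyhedral_cone_normals T l s" and i: "i \<in> {1..l}"
  shows "span (cone_facet T (s i)) = {y. s i \<bullet> y = 0}"
proof -
  let ?F = "cone_facet T (s i)"
  have "?F facet_of T"
    using T i by (auto simp: polyhedral_cone_normals_def bij_betw_def)
  moreover have "aff_dim T = int DIM('a)"
    using T unfolding polyhedral_cone_normals_def by blast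
  ultimately have "aff_dim ?F = int DIM('a) - 1"
    by (simp add: facet_of_def)
  moreover have "0 \<in> ?F"
    using T by (simp add: polyhedral_cone_normals_def cone_facet_def)
  then have "aff_dim ?F = int (dim ?F)"
    by (intro aff_dim_zero hull_inc)
  moreover have "norm (s i) = 1"
    using T i unfolding polyhedral_cone_normals_def by blast
  then have "s i \<noteq> 0"
    by auto
  ultimately have "dim {y. s i \<bullet> y = 0} \<le> dim ?F"
    by (simp add: dim_hyperplane)
  moreover have "?F \<subseteq> {y. s i \<bullet> y = 0}"
    by (auto simp: cone_facet_def)
  ultimately have "span ?F = span {y. s i \<bullet> y = 0}"
    using dim_eq_span by blast
  then show ?thesis
    by (simp add: span_eq_iff[THEN iffD2, OF subspace_hyperplane])
qed

lemma AE_std_gaussian_not_in_hyperplane: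
  fixes a :: "'a::euclidean_space"
  assumes "a \<noteq> 0"
  shows "AE y in std_gaussian. a \<bullet> y \<noteq> 0"
proof -
  have "{y. a \<bullet> y = 0} \<in> null_sets lebesgue"
    using assms negligible_hyperplane[of a 0] by (simp add: negligible_iff_null_sets)
  then have "{y. a \<bullet> y = 0} \<in> null_sets lborel"
    by (subst (asm) null_sets_completion_iff) simp_all
  then have "AE y in lborel. a \<bullet> y \<noteq> 0"
    using AE_not_in by fastforce
  then show ?thesis
    by (subst std_gaussian_eq, subst AE_density) auto
qed

context
  fixes T :: "'a::euclidean_space set" and l :: nat and s :: "nat \<Rightarrow> 'a" and w :: 'a
  assumes T: "polyhedral_cone_normals T l s"
begin

text \<open>The points of \<open>T\<^sup>i + [0,1) w\<close>, where \<open>T\<^sup>i\<close> is the \<open>i\<close>-th facet.\<close>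

definition swept :: "nat \<Rightarrow> 'a set" where
  "swept i = {y. s i \<bullet> y \<in> {0..<s i \<bullet> w} \<and>
    y - (s i \<bullet> y / (s i \<bullet> w)) *\<^sub>R w \<in> cone_facet T (s i)}"

definition incoming :: "nat set" where
  "incoming = {i \<in> {1..l}. s i \<bullet> w > 0}"

lemma finite_incoming: "finite incoming"
  by (simp add: incoming_def)

lemma mem_T: "y \<in> T \<longleftrightarrow> (\<forall>i\<in>{1..l}. s i \<bullet> y \<ge> 0)"
  using T by (simp add: polyhedral_cone_normals_def inner_commute)

lemma norm_normal: "i \<in> {1..l} \<Longrightarrow> norm (s i) = 1"
  using T by (simp add: polyhedral_cone_normals_def)

lemma T_borel [measurable]: "T \<in> sets borel"
proof -
  have "T = (\<Inter>i\<in>{1..l}. {y. s i \<bullet> y \<ge> 0})"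
    by (auto simp: mem_T)
  moreover have "closed \<dots>"
    by (intro closed_INT ballI closed_halfspace_ge)
  ultimately show ?thesis
    by simp
qed

lemma cone_facet_borel [measurable]: "cone_facet T (s i) \<in> sets borel"
  unfolding cone_facet_def by measurable

lemma swept_borel [measurable]: "swept i \<in> sets borel"
  unfolding swept_def by measurable

lemma cone_facet_scale: "c > 0 \<Longrightarrow> x \<in> cone_facet T (s i) \<Longrightarrow> c *\<^sub>R x \<in> cone_facet T (s i)"
  by (auto simp: cone_facet_def mem_T)

lemma mem_margin: "y \<in> margin T w \<longleftrightarrow> y \<in> T \<and> y - w \<notin> T"
  by (auto simp: margin_def image_iff)

lemma margin_borel [measurable]: "margin T w \<in> sets borel"
proof -
  have "margin T w = {y. y \<in> T \<and> y - w \<notin> T}"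
    by (auto simp: mem_margin)
  then show ?thesis
    by simp
qed

text \<open>Moving from a point of the margin in direction \<open>- w\<close>, one leaves \<open>T\<close> through some facet.\<close>

lemma margin_subset: "margin T w \<subseteq> (\<Union>i\<in>incoming. swept i)"
proof
  fix y
  assume "y \<in> margin T w"
  then have y: "y \<in> T" "y - w \<notin> T"
    by (simp_all add: mem_margin)
  define J where "J = {i \<in> {1..l}. s i \<bullet> (y - w) < 0}"
  define t where "t i = s i \<bullet> y / (s i \<bullet> w)" for i
  have "J \<noteq> {}" "finite J"
    using y(2) by (auto simp: J_def mem_T)
  then obtain i where i: "i \<in> J" and min: "\<And>j. j \<in> J \<Longrightarrow> t i \<le> t j"
    using arg_min_if_finite[of J t] by (metis linorder_not_less)
  have J: "0 \<le> s j \<bullet> y" "s j \<bullet> y < s j \<bullet> w" if "j \<in> J" for j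
    using that y(1) by (auto simp: J_def mem_T inner_diff_right)
  have i': "i \<in> {1..l}" "s i \<bullet> w > 0"
    using i J[OF i] by (auto simp: J_def)
  have t: "0 \<le> t i" "t i < 1"
    using J[OF i] by (auto simp: t_def)
  have "s j \<bullet> (y - t i *\<^sub>R w) \<ge> 0" if j: "j \<in> {1..l}" for j
  proof -
    have "t i * (s j \<bullet> w) \<le> s j \<bullet> y"
    proof (cases "s j \<bullet> w \<le> 0")
      case True
      then have "t i * (s j \<bullet> w) \<le> 0"
        using t by (simp add: mult_nonneg_nonpos)
      then show ?thesis
        using y(1) j by (force simp: mem_T)
    next
      case False
      show ?thesis
      proof (cases "j \<in> J")
        case True
        then show ?thesis
          using min[OF True] False by (simp add: t_def[of j] field_simps)
      next
        case notJ: False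
        then have "s j \<bullet> w \<le> s j \<bullet> y"
          using j by (auto simp: J_def inner_diff_right)
        moreover have "t i * (s j \<bullet> w) \<le> s j \<bullet> w"
          using t False by (simp add: mult_left_le_one_le)
        ultimately show ?thesis
          by linarith
      qed
    qed
    then show ?thesis
      by (simp add: inner_diff_right)
  qed
  then have "y - t i *\<^sub>R w \<in> cone_facet T (s i)"
    using i' by (auto simp: cone_facet_def mem_T inner_diff_right t_def)
  then have "y \<in> swept i"
    using J[OF i] by (simp add: swept_def t_def)
  then show "y \<in> (\<Union>i\<in>incoming. swept i)"
    using i' by (auto simp: incoming_def)
qed

lemma swept_subset_margin:
  assumes w: "w \<in> T" and i: "i \<in> incoming"
  shows "swept i \<subseteq> margin T w"
proof
  fix y
  assume y: "y \<in> swept i"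
  define t where "t = s i \<bullet> y / (s i \<bullet> w)"
  have t: "t \<ge> 0" and yt: "y - t *\<^sub>R w \<in> T"
    using y by (auto simp: swept_def t_def cone_facet_def)
  have "s j \<bullet> y \<ge> 0" if "j \<in> {1..l}" for j
  proof -
    have "s j \<bullet> (y - t *\<^sub>R w) \<ge> 0" "s j \<bullet> w \<ge> 0"
      using yt w that by (simp_all add: mem_T)
    then show ?thesis
      using t by (simp add: inner_diff_right) (meson mult_nonneg_nonneg order_trans)
  qed
  moreover have "s i \<bullet> (y - w) < 0"
    using y by (simp add: swept_def inner_diff_right)
  ultimately show "y \<in> margin T w"
    using i by (force simp: mem_margin mem_T incoming_def)
qed

text \<open>
  A common point \<open>y\<close> reaches both facets at the same time when moved in direction \<open>- w\<close>,
  since it would otherwise have left \<open>T\<close> through one of them before reaching the other.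
\<close>

lemma AE_swept_disjoint:
  assumes i: "i \<in> incoming" and j: "j \<in> incoming" and ij: "i \<noteq> j"
  shows "AE y in std_gaussian. y \<notin> swept i \<or> y \<notin> swept j"
proof -
  define a where "a k = (1 / (s k \<bullet> w)) *\<^sub>R s k" for k
  have a: "a k \<bullet> y = s k \<bullet> y / (s k \<bullet> w)" for k y
    by (simp add: a_def)
  have le: "a k \<bullet> y \<le> a m \<bullet> y"
    if "k \<in> incoming" "m \<in> incoming" "y \<in> swept k" "y \<in> swept m" for k m y
  proof -
    have "y - (a k \<bullet> y) *\<^sub>R w \<in> T"
      using that by (simp add: swept_def a cone_facet_def)
    then have "0 \<le> s m \<bullet> (y - (a k \<bullet> y) *\<^sub>R w)"
      using that by (simp add: mem_T incoming_def)
    then show ?thesis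
      using that by (simp add: inner_diff_right a[of m] incoming_def pos_le_divide_eq)
  qed
  have "a i \<noteq> a j"
  proof
    assume eq: "a i = a j"
    then have "norm (a i) = norm (a j)"
      by simp
    then have "s i \<bullet> w = s j \<bullet> w"
      using i j by (simp add: a_def incoming_def norm_normal)
    with eq have "s i = s j"
      using i by (simp add: a_def incoming_def)
    then have "cone_facet T (s i) = cone_facet T (s j)"
      by simp
    moreover have "inj_on (\<lambda>i. cone_facet T (s i)) {1..l}"
      using T unfolding polyhedral_cone_normals_def bij_betw_def by blast
    ultimately show False
      using i j ij by (auto simp: incoming_def dest: inj_onD)
  qed
  then have "AE y in std_gaussian. (a i - a j) \<bullet> y \<noteq> 0"
    by (intro AE_std_gaussian_not_in_hyperplane) simp
  then show ?thesis
  proof eventually_elim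
    case (elim y)
    then show ?case
      using le[OF i j, of y] le[OF j i, of y] by (auto simp: inner_diff_left)
  qed
qed

lemma margin_F_eq:
  "margin_F T l s w = (\<Sum>i\<in>incoming. 1 / sqrt (2 * pi) *
    (measure std_gaussian {x. perp (s i) x \<in> cone_facet T (s i)} * (s i \<bullet> w)))"
proof -
  have "margin_F T l s w = (\<Sum>i\<in>{1..l}. 1 / sqrt (2 * pi) *
      (gaussian_rel (cone_facet T (s i)) * max 0 (s i \<bullet> w)))"
    unfolding margin_F_def by (rule sum_distrib_left)
  also have "\<dots> = (\<Sum>i\<in>incoming. 1 / sqrt (2 * pi) *
      (gaussian_rel (cone_facet T (s i)) * max 0 (s i \<bullet> w)))"
    by (rule sum.mono_neutral_right) (auto simp: incoming_def)
  also have "\<dots> = (\<Sum>i\<in>incoming. 1 / sqrt (2 * pi) *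
      (measure std_gaussian {x. perp (s i) x \<in> cone_facet T (s i)} * (s i \<bullet> w)))"
    by (rule sum.cong)
      (auto simp: incoming_def gaussian_rel_def span_cone_facet[OF T] orth_proj_hyperplane norm_normal)
  finally show ?thesis .
qed

lemma measure_margin_le:
  "measure std_gaussian (margin T w) \<le> margin_F T l s w * exp (sqrt (real (DIM('a) - 1)) * norm w)"
proof -
  interpret prob_space "std_gaussian :: 'a measure"
    by (rule prob_space_std_gaussian)
  have "measure std_gaussian (margin T w) \<le> measure std_gaussian (\<Union>i\<in>incoming. swept i)"
    using finite_incoming by (intro finite_measure_mono margin_subset sets.finite_UN) auto
  also have "\<dots> \<le> (\<Sum>i\<in>incoming. measure std_gaussian (swept i))"
    using finite_incoming by (intro finite_measure_subadditive_finite) auto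
  also have "\<dots> \<le> (\<Sum>i\<in>incoming. 1 / sqrt (2 * pi) *
      (measure std_gaussian {x. perp (s i) x \<in> cone_facet T (s i)} * (s i \<bullet> w)) *
      exp (sqrt (real (DIM('a) - 1)) * norm w))"
    unfolding swept_def
    by (intro sum_mono gauss_sheared_slab_bounds(1) cone_facet_borel cone_facet_scale)
      (auto simp: incoming_def norm_normal)
  finally show ?thesis
    by (simp add: margin_F_eq sum_distrib_right)
qed

lemma measure_margin_ge:
  assumes w: "w \<in> T"
  shows "measure std_gaussian (margin T w) \<ge> margin_F T l s w *
    exp (- (sqrt (real (DIM('a) - 1)) * norm w) - 1 / 2 * (norm w)\<^sup>2)"
proof -
  interpret prob_space "std_gaussian :: 'a measure"
    by (rule prob_space_std_gaussian)
  have "margin_F T l s w * exp (- (sqrt (real (DIM('a) - 1)) * norm w) - 1 / 2 * (norm w)\<^sup>2) =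
      (\<Sum>i\<in>incoming. 1 / sqrt (2 * pi) *
      (measure std_gaussian {x. perp (s i) x \<in> cone_facet T (s i)} * (s i \<bullet> w)) *
      exp (- (sqrt (real (DIM('a) - 1)) * norm w) - 1 / 2 * (norm w)\<^sup>2))"
    unfolding margin_F_eq by (rule sum_distrib_right)
  also have "\<dots> \<le> (\<Sum>i\<in>incoming. measure std_gaussian (swept i))"
    unfolding swept_def
    by (intro sum_mono gauss_sheared_slab_bounds(2) cone_facet_borel cone_facet_scale)
      (auto simp: incoming_def norm_normal)
  also have "\<dots> = measure std_gaussian (\<Union>i\<in>incoming. swept i)"
    using finite_incoming AE_swept_disjoint
    by (intro measure_UNION_AE[symmetric]) (auto simp: pairwise_def fmeasurable_eq_sets)
  also have "\<dots> \<le> measure std_gaussian (margin T w)"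
    using swept_subset_margin[OF w] by (intro finite_measure_mono UN_least) auto
  finally show ?thesis .
qed

end

theorem lemma3p2:
  fixes T :: "(real ^ 'n) set" and l :: nat and s :: "nat \<Rightarrow> real ^ 'n" and w :: "real ^ 'n"
  assumes "polyhedral_cone_normals T l s"
  shows "measure std_gaussian (margin T w)
           \<le> 2 * margin_F T l s w * exp (sqrt (real CARD('n) - 1) * norm w) \<and>
         (w \<in> T \<longrightarrow>
          measure std_gaussian (margin T w)
           \<ge> margin_F T l s w * exp (- (sqrt (real CARD('n) - 1) * norm w) - 1 / 2 * (norm w)\<^sup>2))"
proof -
  have dim: "real (DIM(real ^ 'n) - 1) = real CARD('n) - 1"
    by (simp add: of_nat_diff Suc_leI)
  have "margin_F T l s w * exp (sqrt (real CARD('n) - 1) * norm w) \<ge> 0"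
    unfolding margin_F_def gaussian_rel_def
    by (intro mult_nonneg_nonneg sum_nonneg) auto
  then show ?thesis
    using measure_margin_le[OF assms, of w] measure_margin_ge[OF assms, of w] unfolding dim
    by auto
qed

end
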